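(* Let $A$ be an aggregation operator and let $(M,\tilde{\circ})$ be an $A$-vague monoid with respect to an $A$-indistinguishability operator $E$ on $M$ that separates points. For $x,y\in M$ let $x\circ y$ denote the unique $z\in M$ such that $\tilde{\circ}(x,y,z)=1$. Then $(M,\circ)$ is a monoid.
   Context: An aggregation operator $A$ is understood here as a family of maps $A:[0,1]^n\to[0,1]$ ($n\ge 2$), each non-decreasing in every argument with $A(0,\dots,0)=0$ and $A(1,\dots,1)=1$; $A$ applied to $n$ arguments means the $n$-ary member. An $A$-indistinguishability operator on $M$ is a map $E:M\times M\to[0,1]$ with $E(x,x)=1$, $E(x,y)=E(y,x)$ and $A(E(x,y),E(y,z))\le E(x,z)$ for all $x,y,z\in M$; $E$ separates points if $E(x,y)=1$ implies $x=y$. An $A$-vague binary operation on $M$ (with respect to $E$) is a map $\tilde{\circ}:M^3\to[0,1]$ such that for all $x,y,z,x',y',z'\in M$: (1) $A(\tilde{\circ}(x,y,z),E(x,x'),E(y,y'),E(z,z'))\le\tilde{\circ}(x',y',z')$; (2) $A(\tilde{\circ}(x,y,z),\tilde{\circ}(x,y,z'))\le E(z,z')$; (3) for all $x,y\in M$ there is $z\in M$ with $\tilde{\circ}(x,y,z)=1$ (this $z$ is unique when $E$ separates points). $(M,\tilde{\circ})$ is an $A$-vague monoid if moreover: (associativity) $A(\tilde{\circ}(y,z,d),\tilde{\circ}(x,d,m),\tilde{\circ}(x,y,q),\tilde{\circ}(q,z,w))\le E(m,w)$ for all $x,y,z,d,m,q,w\in M$; (identity) there is $e\in M$ with $\tilde{\circ}(e,x,x)=1=\tilde{\circ}(x,e,x)$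 for all $x\in M$. *)

theory Defs
  imports Complex_Main "HOL-Algebra.Group"
begin

definition in_unit_cube :: "real list \<Rightarrow> bool" where
  "in_unit_cube xs \<longleftrightarrow> set xs \<subseteq> {0..1}"

text \<open>A family of maps from the unit \<open>n\<close>-cube to the unit interval, \<open>n \<ge> 2\<close>, is a function on
  lists; the \<open>n\<close>-ary member is its restriction to lists of length \<open>n\<close> over the unit interval.
  Values at any other list are unconstrained.\<close>

definition aggregation_operator :: "(real list \<Rightarrow> real) \<Rightarrow> bool" where
  "aggregation_operator A \<longleftrightarrow>
     (\<forall>xs. length xs \<ge> 2 \<and> in_unit_cube xs \<longrightarrow> A xs \<in> {0..1}) \<and>
     (\<forall>xs ys. length xs \<ge> 2 \<and> in_unit_cube xs \<and> in_unit_cube ys \<and> list_all2 (\<le>) xs ys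
        \<longrightarrow> A xs \<le> A ys) \<and>
     (\<forall>n\<ge>2. A (replicate n 0) = 0) \<and>
     (\<forall>n\<ge>2. A (replicate n 1) = 1)"

definition indistinguishability_operator ::
  "(real list \<Rightarrow> real) \<Rightarrow> 'a set \<Rightarrow> ('a \<Rightarrow> 'a \<Rightarrow> real) \<Rightarrow> bool" where
  "indistinguishability_operator A M E \<longleftrightarrow>
     (\<forall>x\<in>M. \<forall>y\<in>M. E x y \<in> {0..1}) \<and>
     (\<forall>x\<in>M. E x x = 1) \<and>
     (\<forall>x\<in>M. \<forall>y\<in>M. E x y = E y x) \<and>
     (\<forall>x\<in>M. \<forall>y\<in>M. \<forall>z\<in>M. A [E x y, E y z] \<le> E x z)"

definition separates_points :: "'a set \<Rightarrow> ('a \<Rightarrow> 'a \<Rightarrow> real) \<Rightarrow> bool" where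
  "separates_points M E \<longleftrightarrow> (\<forall>x\<in>M. \<forall>y\<in>M. E x y = 1 \<longrightarrow> x = y)"

definition vague_binary_operation ::
  "(real list \<Rightarrow> real) \<Rightarrow> 'a set \<Rightarrow> ('a \<Rightarrow> 'a \<Rightarrow> real) \<Rightarrow> ('a \<Rightarrow> 'a \<Rightarrow> 'a \<Rightarrow> real) \<Rightarrow> bool" where
  "vague_binary_operation A M E V \<longleftrightarrow>
     (\<forall>x\<in>M. \<forall>y\<in>M. \<forall>z\<in>M. V x y z \<in> {0..1}) \<and>
     (\<forall>x\<in>M. \<forall>y\<in>M. \<forall>z\<in>M. \<forall>x'\<in>M. \<forall>y'\<in>M. \<forall>z'\<in>M.
        A [V x y z, E x x', E y y', E z z'] \<le> V x' y' z') \<and>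
     (\<forall>x\<in>M. \<forall>y\<in>M. \<forall>z\<in>M. \<forall>z'\<in>M. A [V x y z, V x y z'] \<le> E z z') \<and>
     (\<forall>x\<in>M. \<forall>y\<in>M. \<exists>z\<in>M. V x y z = 1)"

definition vague_monoid ::
  "(real list \<Rightarrow> real) \<Rightarrow> 'a set \<Rightarrow> ('a \<Rightarrow> 'a \<Rightarrow> real) \<Rightarrow> ('a \<Rightarrow> 'a \<Rightarrow> 'a \<Rightarrow> real) \<Rightarrow> bool" where
  "vague_monoid A M E V \<longleftrightarrow>
     vague_binary_operation A M E V \<and>
     (\<forall>x\<in>M. \<forall>y\<in>M. \<forall>z\<in>M. \<forall>d\<in>M. \<forall>m\<in>M. \<forall>q\<in>M. \<forall>w\<in>M.
        A [V y z d, V x d m, V x y q, V q z w] \<le> E m w) \<and>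
     (\<exists>e\<in>M. \<forall>x\<in>M. V e x x = 1 \<and> V x e x = 1)"

definition induced_operation ::
  "'a set \<Rightarrow> ('a \<Rightarrow> 'a \<Rightarrow> 'a \<Rightarrow> real) \<Rightarrow> 'a \<Rightarrow> 'a \<Rightarrow> 'a" where
  "induced_operation M V x y = (THE z. z \<in> M \<and> V x y z = 1)"

text \<open>The description above is proper as soon as \<open>E\<close> separates points.\<close>

lemma vague_binary_operation_ex1:
  assumes A: "aggregation_operator A"
    and E: "indistinguishability_operator A M E" "separates_points M E"
    and V: "vague_binary_operation A M E V"
    and xy: "x \<in> M" "y \<in> M"
  shows "\<exists>!z. z \<in> M \<and> V x y z = 1"
proof -
  obtain z where z: "z \<in> M" "V x y z = 1"
    using V xy unfolding vague_binary_operation_def by blast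
  have one: "A [1, 1] = 1"
    using A unfolding aggregation_operator_def by (force simp: numeral_2_eq_2)
  have "z' = z" if z': "z' \<in> M" "V x y z' = 1" for z'
  proof -
    have "A [V x y z', V x y z] \<le> E z' z"
      using V xy z z' unfolding vague_binary_operation_def by blast
    then have "1 \<le> E z' z" using one z z' by simp
    moreover have "E z' z \<le> 1"
      using E(1) z z' unfolding indistinguishability_operator_def by auto
    ultimately show ?thesis using E(2) z z' unfolding separates_points_def by auto
  qed
  with z show ?thesis by blast
qed

end

theory Submission imports Defs
begin

text \<open>Evaluate the vague laws at degree 1. If all four degrees in vague associativity are 1,
  then \<open>A [1, 1, 1, 1] = 1\<close> bounds \<open>E\<close> from below by 1, and separation of
  points turns this into an equality of the two triple products. Closure and well-definedness come
  from \<open>vague_binary_operation_ex1\<close>; its uniqueness part also gives the unit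
  laws.\<close>

text \<open>\<open>E\<close> is bounded by 1 on \<open>M\<close>, so the lower bound that vague
  associativity yields forces the value 1.\<close>

lemma eq_if_indistinguishability_ge_1:
  assumes "indistinguishability_operator A M E" "separates_points M E"
    and "x \<in> M" "y \<in> M" "1 \<le> E x y"
  shows "x = y"
proof -
  have "E x y \<le> 1"
    using assms unfolding indistinguishability_operator_def by auto
  then show ?thesis
    using assms unfolding separates_points_def by auto
qed

theorem proposition4p4:
  fixes A :: "real list \<Rightarrow> real"
    and M :: "'a set"
    and E :: "'a \<Rightarrow> 'a \<Rightarrow> real"
    and V :: "'a \<Rightarrow> 'a \<Rightarrow> 'a \<Rightarrow> real"
  assumes "aggregation_operator A"
    and "indistinguishability_operator A M E"
    and "separates_points M E"
    and "vague_monoid A M E V"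
  shows "\<exists>e. Group.monoid \<lparr>carrier = M, mult = induced_operation M V, one = e\<rparr>"
proof -
  have V: "vague_binary_operation A M E V"
    and assoc: "\<And>x y z d m q w. \<lbrakk>x \<in> M; y \<in> M; z \<in> M; d \<in> M; m \<in> M; q \<in> M; w \<in> M\<rbrakk>
      \<Longrightarrow> A [V y z d, V x d m, V x y q, V q z w] \<le> E m w"
    using assms(4) unfolding vague_monoid_def by blast+
  obtain e where e: "e \<in> M" "\<And>x. x \<in> M \<Longrightarrow> V e x x = 1 \<and> V x e x = 1"
    using assms(4) unfolding vague_monoid_def by blast
  let ?op = "induced_operation M V"
  note ex1 = vague_binary_operation_ex1[OF assms(1-3) V]
  have op: "?op x y \<in> M" "V x y (?op x y) = 1" if "x \<in> M" "y \<in> M" for x y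
    using theI'[OF ex1[OF that]] unfolding induced_operation_def by auto
  have op_eq: "?op x y = z" if "x \<in> M" "y \<in> M" "z \<in> M" "V x y z = 1" for x y z
    using ex1[of x y] op[of x y] that by blast
  have "A (replicate 4 1) = 1"
    using assms(1) unfolding aggregation_operator_def by force
  then have one: "A [1, 1, 1, 1] = 1"
    by (simp add: eval_nat_numeral)
  have op_assoc: "?op (?op x y) z = ?op x (?op y z)"
    if "x \<in> M" "y \<in> M" "z \<in> M" for x y z
  proof -
    \<comment> \<open>With \<open>d\<close>, \<open>m\<close>, \<open>q\<close>, \<open>w\<close>
      chosen as the actual products, each argument of \<open>A\<close> has the form
      \<open>V a b (?op a b)\<close>, hence equals 1.\<close>
    have "1 \<le> E (?op x (?op y z)) (?op (?op x y) z)"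
      using assoc[of x y z "?op y z" "?op x (?op y z)" "?op x y" "?op (?op x y) z"]
      by (simp add: op that one)
    then show ?thesis
      using eq_if_indistinguishability_ge_1[OF assms(2,3)] op that by metis
  qed
  \<comment> \<open>For the unit laws, \<open>V e x x = 1\<close> and \<open>V x e x = 1\<close>
    exhibit \<open>x\<close> as the product, so \<open>op_eq\<close> applies.\<close>
  have "Group.monoid \<lparr>carrier = M, mult = ?op, one = e\<rparr>"
    by (rule monoidI) (simp_all add: op op_assoc op_eq e)
  then show ?thesis ..
qed

end
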